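(* Let $\mathbf{K}$ be a field of characteristic different from $2$ and let $A$ be a (not necessarily associative) algebra over $\mathbf{K}$. For $a,b,c\in A$ put $\langle a,b,c\rangle=(ab)c-a(bc)+b(ac)$. Then $A$ is a binary Leibniz algebra if and only if $A$ satisfies the identities $$\langle a,a,b\rangle=0,\qquad \langle a,b,a\rangle=0,\qquad \langle a,b,ab\rangle=0\qquad\text{for all } a,b\in A.$$
   Context: A (left) Leibniz algebra is an algebra satisfying $(ab)c=a(bc)-b(ac)$ for all $a,b,c$, i.e. $\langle a,b,c\rangle=0$. An algebra $A$ is called a binary Leibniz algebra if every subalgebra of $A$ generated by two elements is a Leibniz algebra. *)

theory Defs
  imports Complex_Main
begin

definition nonassoc_algebra ::
  "('k::field \<Rightarrow> 'a::ab_group_add \<Rightarrow> 'a) \<Rightarrow> ('a \<Rightarrow> 'a \<Rightarrow> 'a) \<Rightarrow> bool" where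
  "nonassoc_algebra scale mult \<longleftrightarrow>
     vector_space scale \<and>
     (\<forall>x y z. mult (x + y) z = mult x z + mult y z) \<and>
     (\<forall>x y z. mult x (y + z) = mult x y + mult x z) \<and>
     (\<forall>c x y. mult (scale c x) y = scale c (mult x y)) \<and>
     (\<forall>c x y. mult x (scale c y) = scale c (mult x y))"

definition is_subalgebra ::
  "('k::field \<Rightarrow> 'a::ab_group_add \<Rightarrow> 'a) \<Rightarrow> ('a \<Rightarrow> 'a \<Rightarrow> 'a) \<Rightarrow> 'a set \<Rightarrow> bool" where
  "is_subalgebra scale mult B \<longleftrightarrow>
     0 \<in> B \<and>
     (\<forall>x\<in>B. \<forall>y\<in>B. x + y \<in> B) \<and>
     (\<forall>c. \<forall>x\<in>B. scale c x \<in> B) \<and>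
     (\<forall>x\<in>B. \<forall>y\<in>B. mult x y \<in> B)"

definition subalg_gen ::
  "('k::field \<Rightarrow> 'a::ab_group_add \<Rightarrow> 'a) \<Rightarrow> ('a \<Rightarrow> 'a \<Rightarrow> 'a) \<Rightarrow> 'a set \<Rightarrow> 'a set" where
  "subalg_gen scale mult S = \<Inter>{B. is_subalgebra scale mult B \<and> S \<subseteq> B}"

definition lassoc :: "('a::ab_group_add \<Rightarrow> 'a \<Rightarrow> 'a) \<Rightarrow> 'a \<Rightarrow> 'a \<Rightarrow> 'a \<Rightarrow> 'a" where
  "lassoc mult a b c = mult (mult a b) c - mult a (mult b c) + mult b (mult a c)"

definition leibniz_on :: "('a::ab_group_add \<Rightarrow> 'a \<Rightarrow> 'a) \<Rightarrow> 'a set \<Rightarrow> bool" where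
  "leibniz_on mult B \<longleftrightarrow> (\<forall>a\<in>B. \<forall>b\<in>B. \<forall>c\<in>B. lassoc mult a b c = 0)"

definition binary_leibniz ::
  "('k::field \<Rightarrow> 'a::ab_group_add \<Rightarrow> 'a) \<Rightarrow> ('a \<Rightarrow> 'a \<Rightarrow> 'a) \<Rightarrow> bool" where
  "binary_leibniz scale mult \<longleftrightarrow>
     (\<forall>x y. leibniz_on mult (subalg_gen scale mult {x, y}))"

end

theory Submission
  imports Defs
begin

text \<open>
  The identities imply that \<open>J(a,b,c) = (ab)c - a(bc) + b(ac)\<close> is alternating, vanishes when an
  argument lies in the left annihilator, and satisfies \<open>J(a,b,ab) = 0\<close>. The proof that \<open>J\<close> vanishes
  on all monomials in two elements is by induction on the total degree, carried out simultaneously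
  for all trilinear maps \<open>f\<close> with these three properties: once \<open>J\<close> vanishes in smaller degrees, left
  multiplications are derivations, so the derivative of \<open>f\<close> along a left multiplication has the same
  properties in smaller degree and vanishes. Hence \<open>f\<close> is invariant, and invariance together with
  \<open>f(a,b,ab) = 0\<close> makes \<open>f(ab,c,d)\<close> alternating in all four arguments. Then
  \<open>f((ab)c,d,e)\<close> is, up to sign, a function on the ten pairs \<open>{a,b}\<close> out of five arguments which
  changes sign along the edges of the Petersen graph (disjoint pairs); as that graph contains a
  5-cycle, the function is zero. So \<open>f(ab,c,d)\<close> vanishes unless all of \<open>a,b,c,d\<close> are among the two
  generators, where it vanishes because it is alternating.
\<close>

locale leibnizator_alternating =
  fixes scale :: "'k::field \<Rightarrow> 'a::ab_group_add \<Rightarrow> 'a"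
    and mult :: "'a \<Rightarrow> 'a \<Rightarrow> 'a"  (infixl "\<cdot>" 70)
  assumes two_neq_zero: "(2::'k) \<noteq> 0"
    and algebra: "nonassoc_algebra scale mult"
    and lassoc_left: "lassoc mult a a b = 0"
    and lassoc_outer: "lassoc mult a b a = 0"
    and lassoc_product: "lassoc mult a b (a \<cdot> b) = 0"
begin

section \<open>Trilinearity of the leibnizator\<close>

sublocale vector_space scale
  using algebra by (simp add: nonassoc_algebra_def)

abbreviation J :: "'a \<Rightarrow> 'a \<Rightarrow> 'a \<Rightarrow> 'a" where "J \<equiv> lassoc mult"

lemma mult_add_left: "(a + b) \<cdot> c = a \<cdot> c + b \<cdot> c"
  and mult_add_right: "a \<cdot> (b + c) = a \<cdot> b + a \<cdot> c"
  and mult_scale_left: "scale r a \<cdot> b = scale r (a \<cdot> b)"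
  and mult_scale_right: "a \<cdot> scale r b = scale r (a \<cdot> b)"
  using algebra by (auto simp: nonassoc_algebra_def)

lemma mult_zero_left [simp]: "0 \<cdot> a = 0"
  using mult_add_left[of 0 0 a] by simp

lemma mult_zero_right [simp]: "a \<cdot> 0 = 0"
  using mult_add_right[of a 0 0] by simp

lemma J_add:
  "J (a + a') b c = J a b c + J a' b c"
  "J a (b + b') c = J a b c + J a b' c"
  "J a b (c + c') = J a b c + J a b c'"
  by (simp_all add: lassoc_def mult_add_left mult_add_right algebra_simps)

lemma J_scale:
  "J (scale r a) b c = scale r (J a b c)"
  "J a (scale r b) c = scale r (J a b c)"
  "J a b (scale r c) = scale r (J a b c)"
  by (simp_all add: lassoc_def mult_scale_left mult_scale_right
      scale_right_distrib scale_right_diff_distrib)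

lemma J_zero [simp]: "J 0 b c = 0" "J a 0 c = 0" "J a b 0 = 0"
  by (simp_all add: lassoc_def)

lemma double_eq_zero: "u + u = (0::'a) \<Longrightarrow> u = 0"
proof -
  assume "u + u = 0"
  moreover have "u + u = scale 2 u"
    using scale_left_distrib[of 1 1 u] by simp
  ultimately show "u = 0"
    using two_neq_zero by simp
qed

section \<open>Monomials in two elements and alternating trilinear maps\<close>

definition left_annihilator :: "'a set" where
  "left_annihilator = {s. \<forall>t. s \<cdot> t = 0}"

text \<open>The degree is an index of the relation, not a function of the element: \<open>x\<close>
  and \<open>y\<close> need not be free, so one element may be a monomial in several
  degrees.\<close>

inductive monomial :: "'a \<Rightarrow> 'a \<Rightarrow> nat \<Rightarrow> 'a \<Rightarrow> bool" for x y where
  fst: "monomial x y 1 x"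
| snd: "monomial x y 1 y"
| mult: "monomial x y i u \<Longrightarrow> monomial x y j v \<Longrightarrow> monomial x y (i + j) (u \<cdot> v)"

lemma monomial_degree_pos: "monomial x y k u \<Longrightarrow> k > 0"
  by (induction rule: monomial.induct) auto

text \<open>The clause on \<open>left_annihilator\<close> makes \<open>f (a \<cdot> b) c d\<close>
  skew in \<open>a\<close> and \<open>b\<close>, because anticommutators lie there. The class is
  closed under \<open>derivative\<close>, so the induction can run over all its members.\<close>

definition alternating_map :: "('a \<Rightarrow> 'a \<Rightarrow> 'a \<Rightarrow> 'a) \<Rightarrow> bool" where
  "alternating_map f \<longleftrightarrow>
     (\<forall>a a' b c. f (a + a') b c = f a b c + f a' b c) \<and>
     (\<forall>a b b' c. f a (b + b') c = f a b c + f a b' c) \<and>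
     (\<forall>a b c c'. f a b (c + c') = f a b c + f a b c') \<and>
     (\<forall>a b. f a a b = 0) \<and> (\<forall>a b. f a b b = 0) \<and>
     (\<forall>s\<in>left_annihilator. \<forall>b c. f s b c = 0)"

text \<open>The polarised form of \<open>f(a,b,ab) = 0\<close>, which can be asked for in a single degree.\<close>

definition product_identity :: "'a \<Rightarrow> 'a \<Rightarrow> nat \<Rightarrow> ('a \<Rightarrow> 'a \<Rightarrow> 'a \<Rightarrow> 'a) \<Rightarrow> bool" where
  "product_identity x y m f \<longleftrightarrow>
     (\<forall>i j k l a b c d. monomial x y i a \<longrightarrow> monomial x y j b \<longrightarrow> monomial x y k c \<longrightarrow>
        monomial x y l d \<longrightarrow> i + j + k + l = m \<longrightarrow>
        f (a \<cdot> b) c d + f (c \<cdot> d) a b + f (a \<cdot> d) c b + f (c \<cdot> b) a d = 0)"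

definition vanishes_in_degree :: "'a \<Rightarrow> 'a \<Rightarrow> nat \<Rightarrow> ('a \<Rightarrow> 'a \<Rightarrow> 'a \<Rightarrow> 'a) \<Rightarrow> bool" where
  "vanishes_in_degree x y m f \<longleftrightarrow>
     (\<forall>i j k a b c. monomial x y i a \<longrightarrow> monomial x y j b \<longrightarrow> monomial x y k c \<longrightarrow>
        i + j + k = m \<longrightarrow> f a b c = 0)"

lemma alternating_mapD:
  assumes "alternating_map f"
  shows "f (a + a') b c = f a b c + f a' b c"
    and "f a (b + b') c = f a b c + f a b' c"
    and "f a b (c + c') = f a b c + f a b c'"
    and "f a a b = 0" and "f a b b = 0"
    and "s \<in> left_annihilator \<Longrightarrow> f s b c = 0"
  using assms unfolding alternating_map_def by blast+

lemma alternating_map_swap: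
  assumes f: "alternating_map f"
  shows "f b a c = - f a b c" and "f a c b = - f a b c"
proof -
  have "f (a + b) (a + b) c = 0"
    by (rule alternating_mapD(4)[OF f])
  then have "f a b c + f b a c = 0"
    by (simp add: alternating_mapD(1,2)[OF f] alternating_mapD(4)[OF f, of a]
        alternating_mapD(4)[OF f, of b] add.commute)
  then show "f b a c = - f a b c"
    by (simp add: add_eq_0_iff)
  have "f a (b + c) (b + c) = 0"
    by (rule alternating_mapD(5)[OF f])
  then have "f a b c + f a c b = 0"
    by (simp add: alternating_mapD(2,3)[OF f] alternating_mapD(5)[OF f, of _ b]
        alternating_mapD(5)[OF f, of _ c] add.commute)
  then show "f a c b = - f a b c"
    by (simp add: add_eq_0_iff)
qed

lemma alternating_map_rotate:
  assumes f: "alternating_map f"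
  shows "f b c a = f a b c"
  using alternating_map_swap(1)[OF f, of b a c] alternating_map_swap(2)[OF f, of b c a] by simp

section \<open>The left annihilator and the basic properties of \<open>J\<close>\<close>

lemma square_in_left_annihilator: "a \<cdot> a \<in> left_annihilator"
  using lassoc_left[of a] by (simp add: left_annihilator_def lassoc_def)

lemma anticommutator_mult_left: "(a \<cdot> b + b \<cdot> a) \<cdot> c = 0"
proof -
  have "((a + b) \<cdot> (a + b)) \<cdot> c = 0" "(a \<cdot> a) \<cdot> c = 0" "(b \<cdot> b) \<cdot> c = 0"
    using square_in_left_annihilator by (auto simp: left_annihilator_def)
  then show ?thesis
    by (simp add: mult_add_left mult_add_right add.commute)
qed

lemma anticommutator_in_left_annihilator: "a \<cdot> b + b \<cdot> a \<in> left_annihilator"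
  by (simp add: left_annihilator_def anticommutator_mult_left)

lemma alternating_map_J: "alternating_map J"
proof -
  have swap: "J b a c = - J a b c" for a b c
    using lassoc_left[of "a + b" c]
    by (simp add: J_add lassoc_left[of a] lassoc_left[of b] add_eq_0_iff)
  have "J a b b = 0" for a b
    using swap[of a b b] lassoc_outer[of b a] by simp
  moreover have "J s b c = 0" if "s \<in> left_annihilator" for s b c
    using that by (simp add: left_annihilator_def lassoc_def)
  ultimately show ?thesis
    unfolding alternating_map_def by (simp add: J_add lassoc_left)
qed

text \<open>The product \<open>(a \<cdot> s) \<cdot> t\<close> is all that remains of
  \<open>J a s t\<close>, and alternation moves \<open>s\<close> to the front, where
  \<open>J\<close> vanishes. Derivatives along left multiplications rely on this closure.\<close>

lemma left_annihilator_mult: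
  assumes "s \<in> left_annihilator"
  shows "a \<cdot> s \<in> left_annihilator"
proof -
  have s: "s \<cdot> t = 0" for t
    using assms by (simp add: left_annihilator_def)
  have "(a \<cdot> s) \<cdot> t = 0" for t
  proof -
    have "(a \<cdot> s) \<cdot> t = J a s t"
      by (simp add: lassoc_def s)
    also have "\<dots> = - J s a t"
      by (rule alternating_map_swap(1)[OF alternating_map_J])
    also have "\<dots> = 0"
      using alternating_mapD(6)[OF alternating_map_J assms] by simp
    finally show ?thesis .
  qed
  then show ?thesis
    by (simp add: left_annihilator_def)
qed

lemma alternating_map_product_swap:
  assumes f: "alternating_map f"
  shows "f (b \<cdot> a) c d = - f (a \<cdot> b) c d"
  using alternating_mapD(6)[OF f anticommutator_in_left_annihilator, of a b c d]
  by (simp add: alternating_mapD(1)[OF f] eq_neg_iff_add_eq_0 add.commute)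

text \<open>The identity \<open>J a b (a \<cdot> b) = 0\<close>, rotated to
  \<open>J (a \<cdot> b) a b = 0\<close>, is linearised first in \<open>a\<close> and then in
  \<open>b\<close>.\<close>

lemma product_identity_J: "product_identity x y m J"
proof -
  note f = alternating_map_J
  have diag: "J (a \<cdot> b) a b = 0" for a b
    using lassoc_product[of a b] alternating_map_rotate[OF f] by metis
  have half: "J (a \<cdot> b) c b + J (c \<cdot> b) a b = 0" for a b c
    using diag[of "a + c" b] by (simp add: mult_add_left J_add diag add.commute)
  have "J (a \<cdot> b) c d + J (c \<cdot> d) a b + J (a \<cdot> d) c b + J (c \<cdot> b) a d = 0" for a b c d
  proof -
    have "J (a \<cdot> b) c d + J (c \<cdot> d) a b + J (a \<cdot> d) c b + J (c \<cdot> b) a d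
        = (J (a \<cdot> (b + d)) c (b + d) + J (c \<cdot> (b + d)) a (b + d))
          - (J (a \<cdot> b) c b + J (c \<cdot> b) a b) - (J (a \<cdot> d) c d + J (c \<cdot> d) a d)"
      by (simp add: mult_add_right J_add algebra_simps)
    then show ?thesis
      by (simp only: half diff_0_right)
  qed
  then show ?thesis
    by (simp add: product_identity_def)
qed

section \<open>Derivatives along left multiplications\<close>

definition derivative :: "'a \<Rightarrow> ('a \<Rightarrow> 'a \<Rightarrow> 'a \<Rightarrow> 'a) \<Rightarrow> 'a \<Rightarrow> 'a \<Rightarrow> 'a \<Rightarrow> 'a" where
  "derivative e f a b c = f (e \<cdot> a) b c + f a (e \<cdot> b) c + f a b (e \<cdot> c)"

text \<open>On equal arguments the two terms that differentiate one of them cancel. Vanishing on the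
  left annihilator survives because left multiplication preserves it.\<close>

lemma alternating_map_derivative:
  assumes f: "alternating_map f"
  shows "alternating_map (derivative e f)"
proof -
  note D = alternating_mapD[OF f]
  have "derivative e f a a b = 0" "derivative e f a b b = 0" for a b
    using alternating_map_swap(1)[OF f, of a "e \<cdot> a" b] alternating_map_swap(2)[OF f, of a b "e \<cdot> b"]
    by (simp_all add: derivative_def D)
  moreover have "derivative e f s b c = 0" if "s \<in> left_annihilator" for s b c
    using that left_annihilator_mult[OF that] by (simp add: derivative_def D)
  ultimately show ?thesis
    unfolding alternating_map_def
    by (simp add: derivative_def D mult_add_right algebra_simps)
qed

text \<open>Where left multiplication by \<open>e\<close> acts as a derivation, differentiating the
  four-term identity amounts to adding its four instances with \<open>e\<close> applied to one
  argument. The degree \<open>h\<close> of \<open>e\<close> is split off from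
  \<open>h + m\<close>.\<close>

lemma product_identity_derivative:
  assumes f: "alternating_map f" and id: "product_identity x y (h + m) f"
    and e: "monomial x y h e"
    and van: "\<And>l. l < h + m \<Longrightarrow> vanishes_in_degree x y l J"
  shows "product_identity x y m (derivative e f)"
  unfolding product_identity_def
proof (intro allI impI)
  fix i j k l a b c d
  assume mon: "monomial x y i a" "monomial x y j b" "monomial x y k c" "monomial x y l d"
    and deg: "i + j + k + l = m"
  have pos: "i > 0" "j > 0" "k > 0" "l > 0"
    using mon monomial_degree_pos by auto
  \<comment> \<open>This is \<open>J e u v = 0\<close> rearranged. The bound
    \<open>p + q < m\<close> will hold because the two arguments outside the product have positive
    degree.\<close>
  have leib: "e \<cdot> (u \<cdot> v) = (e \<cdot> u) \<cdot> v + u \<cdot> (e \<cdot> v)"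
    if "monomial x y p u" "monomial x y q v" "p + q < m" for p q u v
  proof -
    have "J e u v = 0"
      using van[of "h + p + q"] e that unfolding vanishes_in_degree_def by auto
    then show ?thesis
      by (simp add: lassoc_def algebra_simps)
  qed
  have "e \<cdot> (a \<cdot> b) = (e \<cdot> a) \<cdot> b + a \<cdot> (e \<cdot> b)" "e \<cdot> (c \<cdot> d) = (e \<cdot> c) \<cdot> d + c \<cdot> (e \<cdot> d)"
    "e \<cdot> (a \<cdot> d) = (e \<cdot> a) \<cdot> d + a \<cdot> (e \<cdot> d)" "e \<cdot> (c \<cdot> b) = (e \<cdot> c) \<cdot> b + c \<cdot> (e \<cdot> b)"
    using mon deg pos by (auto intro!: leib)
  note leibs = this
  let ?R = "\<lambda>a b c d. f (a \<cdot> b) c d + f (c \<cdot> d) a b + f (a \<cdot> d) c b + f (c \<cdot> b) a d"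
  have em: "monomial x y (h + i) (e \<cdot> a)" "monomial x y (h + j) (e \<cdot> b)"
    "monomial x y (h + k) (e \<cdot> c)" "monomial x y (h + l) (e \<cdot> d)"
    using e mon by (auto intro: monomial.mult)
  have R: "?R (e \<cdot> a) b c d = 0" "?R a (e \<cdot> b) c d = 0" "?R a b (e \<cdot> c) d = 0" "?R a b c (e \<cdot> d) = 0"
    using id[unfolded product_identity_def, rule_format, OF em(1) mon(2-4)]
      id[unfolded product_identity_def, rule_format, OF mon(1) em(2) mon(3,4)]
      id[unfolded product_identity_def, rule_format, OF mon(1,2) em(3) mon(4)]
      id[unfolded product_identity_def, rule_format, OF mon(1-3) em(4)] deg
    by simp_all
  have "derivative e f (a \<cdot> b) c d + derivative e f (c \<cdot> d) a b + derivative e f (a \<cdot> d) c b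
      + derivative e f (c \<cdot> b) a d
      = ?R (e \<cdot> a) b c d + ?R a (e \<cdot> b) c d + ?R a b (e \<cdot> c) d + ?R a b c (e \<cdot> d)"
    by (simp add: derivative_def leibs alternating_mapD(1)[OF f] algebra_simps)
  then show "derivative e f (a \<cdot> b) c d + derivative e f (c \<cdot> d) a b + derivative e f (a \<cdot> d) c b
      + derivative e f (c \<cdot> b) a d = 0"
    by (simp only: R add_0)
qed

section \<open>Alternation in four arguments and nested products\<close>

lemma product_form_alternating:
  assumes f: "alternating_map f" and id: "product_identity x y m f"
    and inv: "\<And>h i j k e a b c. \<lbrakk>monomial x y h e; monomial x y i a; monomial x y j b; monomial x y k c;
      h + i + j + k = m\<rbrakk> \<Longrightarrow> derivative e f a b c = 0"
    and mon: "monomial x y i a" "monomial x y j b" "monomial x y k c" "monomial x y l d"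
    and deg: "i + j + k + l = m"
  shows "f (a \<cdot> d) c b = - f (a \<cdot> b) c d"
proof -
  \<comment> \<open>Skew symmetry in slots 1, 2 and in slots 3, 4 is automatic; together with the
    swap of slots 2 and 4 these transpositions generate all permutations.\<close>
  define q where "q a b c d = f (a \<cdot> b) c d" for a b c d
  have q12: "q b a c d = - q a b c d" and q34: "q a b d c = - q a b c d" for a b c d
    unfolding q_def
    by (rule alternating_map_product_swap[OF f], rule alternating_map_swap(2)[OF f])
  \<comment> \<open>Rotating each term until its product comes first turns invariance into a
    vanishing cyclic sum over the last three slots.\<close>
  have q_inv: "q e u v w + q e v w u + q e w u v = 0" if "derivative e f u v w = 0" for e u v w
    using that alternating_map_rotate[OF f, where a = u and b = "e \<cdot> v" and c = w] alternating_map_rotate[OF f, where a = "e \<cdot> w" and b = u and c = v]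
    by (simp add: derivative_def q_def)
  have R: "q a b c d + q c d a b + q a d c b + q c b a d = 0"
    using id mon deg unfolding product_identity_def q_def by blast
  \<comment> \<open>Invariance along \<open>b\<close> and along \<open>d\<close>: on adding,
    \<open>q b d a c\<close> and \<open>q d b a c\<close> cancel, leaving the four terms of
    \<open>R\<close> with two signs flipped. Combined with \<open>R\<close> this yields twice the
    wanted sum.\<close>
  have "q b a c d + q b c d a + q b d a c = 0"
    using q_inv[OF inv[OF mon(2,1,3,4)]] deg by simp
  moreover have "q d a c b + q d c b a + q d b a c = 0"
    using q_inv[OF inv[OF mon(4,1,3,2)]] deg by simp
  moreover have "q d b a c = - q b d a c" "q b a c d = - q a b c d" "q d a c b = - q a d c b"
    "q b c d a = q c b a d" "q d c b a = q c d a b"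
    using q12 q34 by (metis minus_minus)+
  ultimately have "q c b a d + q c d a b = q a b c d + q a d c b"
    by (simp add: algebra_simps eq_neg_iff_add_eq_0)
  with R have "(q a b c d + q a d c b) + (q a b c d + q a d c b) = 0"
    by (simp add: algebra_simps)
  from double_eq_zero[OF this] show ?thesis
    by (simp add: q_def eq_neg_iff_add_eq_0 add.commute)
qed

lemma nested_product_vanishes:
  assumes f: "alternating_map f"
    and alt: "\<And>i j k l a b c d. \<lbrakk>monomial x y i a; monomial x y j b; monomial x y k c; monomial x y l d;
      i + j + k + l = m\<rbrakk> \<Longrightarrow> f (a \<cdot> d) c b = - f (a \<cdot> b) c d"
    and mon: "monomial x y i1 a1" "monomial x y i2 a2" "monomial x y i3 a3" "monomial x y i4 a4"
      "monomial x y i5 a5"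
    and deg: "i1 + i2 + i3 + i4 + i5 = m"
  shows "f ((a1 \<cdot> a2) \<cdot> a3) a4 a5 = 0"
proof -
  define N where "N a b c d e = f ((a \<cdot> b) \<cdot> c) d e" for a b c d e
  have N45: "N a b c e d = - N a b c d e" for a b c d e
    unfolding N_def by (rule alternating_map_swap(2)[OF f])
  \<comment> \<open>Alternation in four arguments with \<open>a \<cdot> b\<close> taken as a single
    monomial.\<close>
  have N35: "N a b e d c = - N a b c d e"
    if "monomial x y i a" "monomial x y j b" "monomial x y k c" "monomial x y l d" "monomial x y h e"
      "i + j + k + l + h = m" for i j k l h a b c d e
    unfolding N_def using alt[OF monomial.mult[OF that(1,2)] that(3-5)] that(6) by simp
  \<comment> \<open>Exchanging the two pairs is an even permutation, here a chain of six
    transpositions.\<close>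
  have pair_swap: "f (c \<cdot> d) a b = f (a \<cdot> b) c d"
    if "monomial x y i a" "monomial x y j b" "monomial x y k c" "monomial x y l d" "i + j + k + l = m"
    for i j k l a b c d
  proof -
    have "f (a \<cdot> b) c d = - f (a \<cdot> d) c b"
      using alt[OF that(1-4)] that(5) by simp
    also have "\<dots> = f (d \<cdot> a) c b"
      by (simp add: alternating_map_product_swap[OF f, of a d])
    also have "\<dots> = - f (d \<cdot> b) c a"
      using alt[OF that(4,1,3,2)] that(5) by simp
    also have "\<dots> = f (d \<cdot> b) a c"
      by (simp add: alternating_map_swap(2)[OF f, of _ c a])
    also have "\<dots> = - f (d \<cdot> c) a b"
      using alt[OF that(4,2,1,3)] that(5) by simp
    also have "\<dots> = f (c \<cdot> d) a b"
      by (simp add: alternating_map_product_swap[OF f, of c d])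
    finally show ?thesis
      by simp
  qed
  \<comment> \<open>By \<open>rot\<close>, both sides are values of \<open>f\<close> at the two
    products and \<open>e\<close>, with the products in opposite order. This is the sign change
    along an edge of the Petersen graph.\<close>
  have exchange: "N a b c d e = - N c d a b e"
    if M: "monomial x y i a" "monomial x y j b" "monomial x y k c" "monomial x y l d" "monomial x y h e"
      and D: "i + j + k + l + h = m" for i j k l h a b c d e
  proof -
    have rot: "N a b c d e = f (c \<cdot> d) (a \<cdot> b) e"
      if M: "monomial x y i a" "monomial x y j b" "monomial x y k c" "monomial x y l d"
          "monomial x y h e"
        and D: "i + j + k + l + h = m" for i j k l h a b c d e
    proof -
      have "N a b c d e = - N a b e d c"
        using N35[OF M D] by simp
      also have "\<dots> = N a b e c d"
        using N45[of a b e c d] by simp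
      also have "\<dots> = f (c \<cdot> d) (a \<cdot> b) e"
        unfolding N_def using pair_swap[OF M(3,4) monomial.mult[OF M(1,2)] M(5)] D by simp
      finally show ?thesis .
    qed
    have "N c d a b e = f (a \<cdot> b) (c \<cdot> d) e"
      using rot[OF M(3,4,1,2,5)] D by simp
    then show ?thesis
      using rot[OF M D] alternating_map_swap(1)[OF f, of "c \<cdot> d" "a \<cdot> b" e] by simp
  qed
  \<comment> \<open>The 5-cycle \<open>12, 34, 15, 23, 45\<close> of the Petersen graph.\<close>
  have "N a1 a2 a3 a4 a5 = - N a3 a4 a1 a2 a5"
    using exchange[OF mon(1,2,3,4,5)] deg by simp
  also have "\<dots> = N a3 a4 a1 a5 a2"
    by (simp add: N45[of a3 a4 a1 a5 a2])
  also have "\<dots> = - N a1 a5 a3 a4 a2"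
    using exchange[OF mon(3,4,1,5,2)] deg by simp
  also have "\<dots> = N a1 a5 a2 a4 a3"
    using N35[OF mon(1,5,2,4,3)] deg by simp
  also have "\<dots> = - N a1 a5 a2 a3 a4"
    by (simp add: N45[of a1 a5 a2 a3 a4])
  also have "\<dots> = N a2 a3 a1 a5 a4"
    using exchange[OF mon(2,3,1,5,4)] deg by simp
  also have "\<dots> = - N a2 a3 a4 a5 a1"
    using N35[OF mon(2,3,4,5,1)] deg by simp
  also have "\<dots> = N a4 a5 a2 a3 a1"
    using exchange[OF mon(4,5,2,3,1)] deg by simp
  also have "\<dots> = - N a4 a5 a1 a3 a2"
    using N35[OF mon(4,5,1,3,2)] deg by simp
  also have "\<dots> = N a4 a5 a1 a2 a3"
    by (simp add: N45[of a4 a5 a1 a2 a3])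
  also have "\<dots> = - N a1 a2 a4 a5 a3"
    using exchange[OF mon(4,5,1,2,3)] deg by simp
  also have "\<dots> = N a1 a2 a3 a5 a4"
    using N35[OF mon(1,2,3,5,4)] deg by simp
  also have "\<dots> = - N a1 a2 a3 a4 a5"
    by (rule N45)
  \<comment> \<open>Five exchanges and eight swaps among the last three slots give an odd number of
    sign changes.\<close>
  finally have "N a1 a2 a3 a4 a5 + N a1 a2 a3 a4 a5 = 0"
    by (simp add: eq_neg_iff_add_eq_0)
  from double_eq_zero[OF this] show ?thesis
    by (simp add: N_def)
qed

section \<open>The induction on degree\<close>

lemma monomial_product:
  assumes "monomial x y k u" and "u \<notin> {x, y}"
  obtains i j v w where "monomial x y i v" "monomial x y j w" "k = i + j" "u = v \<cdot> w"
  using assms by (cases rule: monomial.cases) auto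

text \<open>Two inductions are nested. The outer one supplies the vanishing of \<open>J\<close>
  below \<open>n\<close>; this one runs over \<open>m\<close> with \<open>f\<close> arbitrary, so
  that it applies to \<open>derivative e f\<close>. The case \<open>m = n\<close>,
  \<open>f = J\<close> advances the outer one.\<close>

lemma vanishes_of_product_identity:
  assumes van: "\<And>l. l < n \<Longrightarrow> vanishes_in_degree x y l J"
    and "m \<le> n" and "alternating_map f" and "product_identity x y m f"
  shows "vanishes_in_degree x y m f"
  using assms(2-)
proof (induction m arbitrary: f rule: less_induct)
  case (less m)
  note f = less.prems(2)
  \<comment> \<open>Splitting off \<open>e\<close> leaves degree \<open>i + j + k < m\<close>, where
    the induction hypothesis covers the derivative.\<close>
  have inv: "derivative e f a b c = 0"
    if "monomial x y h e" "monomial x y i a" "monomial x y j b" "monomial x y k c" "h + i + j + k = m"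
    for h i j k e a b c
  proof -
    have "h > 0"
      using that(1) by (rule monomial_degree_pos)
    moreover have m: "h + (i + j + k) = m"
      using that(5) by simp
    then have "product_identity x y (i + j + k) (derivative e f)"
      using product_identity_derivative[OF f _ that(1), where m = "i + j + k"] less.prems(1,3) van
      by simp
    ultimately have "vanishes_in_degree x y (i + j + k) (derivative e f)"
      using less.IH[OF _ _ alternating_map_derivative[OF f]] m less.prems(1) by simp
    then show ?thesis
      using that unfolding vanishes_in_degree_def by blast
  qed
  have alt: "f (a \<cdot> d) c b = - f (a \<cdot> b) c d"
    if "monomial x y i a" "monomial x y j b" "monomial x y k c" "monomial x y l d" "i + j + k + l = m"
    for i j k l a b c d
    by (rule product_form_alternating[OF f less.prems(3) _ that]) (rule inv)
  have nested: "f ((a \<cdot> b) \<cdot> c) d e = 0"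
    if "monomial x y i a" "monomial x y j b" "monomial x y k c" "monomial x y l d" "monomial x y h e"
      "i + j + k + l + h = m" for i j k l h a b c d e
    by (rule nested_product_vanishes[OF f _ that]) (rule alt)
  have product: "f (a \<cdot> b) c d = 0"
    if mon: "monomial x y i a" "monomial x y j b" "monomial x y k c" "monomial x y l d"
      and deg: "i + j + k + l = m" for i j k l a b c d
  proof -
    \<comment> \<open>Each argument can be moved to the first slot up to sign, so one that is itself
      a product becomes the inner product of \<open>nested\<close>.\<close>
    have to_front: "f (a \<cdot> b) c d = - f (b \<cdot> a) c d" "f (a \<cdot> b) c d = - f (c \<cdot> a) d b"
      "f (a \<cdot> b) c d = f (d \<cdot> a) c b"
    proof -
      show "f (a \<cdot> b) c d = - f (b \<cdot> a) c d"
        by (rule alternating_map_product_swap[OF f])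
      have "f (a \<cdot> c) d b = - f (a \<cdot> b) d c"
        using alt[OF mon(1,2,4,3)] deg by simp
      then show "f (a \<cdot> b) c d = - f (c \<cdot> a) d b"
        using alternating_map_swap(2)[OF f, of "a \<cdot> b" d c]
          alternating_map_product_swap[OF f, of c a d b] by simp
      show "f (a \<cdot> b) c d = f (d \<cdot> a) c b"
        using alt[OF mon deg] alternating_map_product_swap[OF f, of a d c b] by simp
    qed
    show ?thesis
    proof (cases "a \<in> {x, y} \<and> b \<in> {x, y} \<and> c \<in> {x, y} \<and> d \<in> {x, y}")
      case True
      then consider "a = b" | "c = d" | "d = a" | "d = b"
        by blast
      then show ?thesis
      proof cases
        case 1
        then show ?thesis
          using alternating_mapD(6)[OF f square_in_left_annihilator, of a] by simp
      next
        case 2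
        then show ?thesis
          using alternating_mapD(5)[OF f] by simp
      next
        case 3
        then show ?thesis
          using to_front(3) alternating_mapD(6)[OF f square_in_left_annihilator, of a] by simp
      next
        case 4
        \<comment> \<open>The equal arguments \<open>b\<close> and \<open>d\<close> occupy exactly
          the slots that \<open>alt\<close> interchanges.\<close>
        have "f (a \<cdot> b) c b = - f (a \<cdot> b) c b"
          using alt[OF mon deg] unfolding 4 .
        then have "f (a \<cdot> b) c b + f (a \<cdot> b) c b = 0"
          by (simp only: eq_neg_iff_add_eq_0)
        then show ?thesis
          unfolding 4 by (rule double_eq_zero)
      qed
    next
      case False
      then consider "a \<notin> {x, y}" | "b \<notin> {x, y}" | "c \<notin> {x, y}" | "d \<notin> {x, y}"
        by blast
      then show ?thesis
      proof cases
        case 1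
        with mon(1) obtain p q u v
          where p: "monomial x y p u" "monomial x y q v" "i = p + q" "a = u \<cdot> v"
          by (rule monomial_product)
        show ?thesis
          using nested[OF p(1,2) mon(2,3,4)] deg p(3,4) by simp
      next
        case 2
        with mon(2) obtain p q u v
          where p: "monomial x y p u" "monomial x y q v" "j = p + q" "b = u \<cdot> v"
          by (rule monomial_product)
        show ?thesis
          using nested[OF p(1,2) mon(1,3,4)] deg p(3,4) to_front(1) by simp
      next
        case 3
        with mon(3) obtain p q u v
          where p: "monomial x y p u" "monomial x y q v" "k = p + q" "c = u \<cdot> v"
          by (rule monomial_product)
        show ?thesis
          using nested[OF p(1,2) mon(1,4,2)] deg p(3,4) to_front(2) by simp
      next
        case 4
        with mon(4) obtain p q u v
          where p: "monomial x y p u" "monomial x y q v" "l = p + q" "d = u \<cdot> v"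
          by (rule monomial_product)
        show ?thesis
          using nested[OF p(1,2) mon(1,3,2)] deg p(3,4) to_front(3) by simp
      qed
    qed
  qed
  show ?case
    unfolding vanishes_in_degree_def
  proof (intro allI impI)
    fix i j k a b c
    assume mon: "monomial x y i a" "monomial x y j b" "monomial x y k c" and deg: "i + j + k = m"
    note rotate = alternating_map_rotate[OF f, of b c a] alternating_map_rotate[OF f, of c a b]
    show "f a b c = 0"
    proof (cases "a \<in> {x, y} \<and> b \<in> {x, y} \<and> c \<in> {x, y}")
      case True
      then consider "a = b" | "b = c" | "c = a"
        by blast
      then show ?thesis
      proof cases
        case 3
        then show ?thesis
          using rotate(1) alternating_mapD(5)[OF f, of b a] by simp
      qed (simp_all add: alternating_mapD(4,5)[OF f])
    next
      case False
      then consider "a \<notin> {x, y}" | "b \<notin> {x, y}" | "c \<notin> {x, y}"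
        by blast
      then show ?thesis
      proof cases
        case 1
        with mon(1) obtain p q u v
          where p: "monomial x y p u" "monomial x y q v" "i = p + q" "a = u \<cdot> v"
          by (rule monomial_product)
        show ?thesis
          using product[OF p(1,2) mon(2,3)] deg p(3,4) by simp
      next
        case 2
        with mon(2) obtain p q u v
          where p: "monomial x y p u" "monomial x y q v" "j = p + q" "b = u \<cdot> v"
          by (rule monomial_product)
        show ?thesis
          using product[OF p(1,2) mon(3,1)] deg p(3,4) rotate by simp
      next
        case 3
        with mon(3) obtain p q u v
          where p: "monomial x y p u" "monomial x y q v" "k = p + q" "c = u \<cdot> v"
          by (rule monomial_product)
        show ?thesis
          using product[OF p(1,2) mon(1,2)] deg p(3,4) rotate by simp
      qed
    qed
  qed
qed

lemma J_vanishes: "vanishes_in_degree x y n J"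
  by (induction n rule: less_induct)
    (rule vanishes_of_product_identity[OF _ order_refl alternating_map_J product_identity_J])

section \<open>From monomials to the generated subalgebra\<close>

lemma J_vanishes_on_span:
  assumes M: "\<And>a b c. a \<in> M \<Longrightarrow> b \<in> M \<Longrightarrow> c \<in> M \<Longrightarrow> J a b c = 0"
    and abc: "a \<in> span M" "b \<in> span M" "c \<in> span M"
  shows "J a b c = 0"
proof -
  have 1: "J a b c = 0" if "a \<in> M" "b \<in> M" "c \<in> span M" for a b c
    using that(3) by (rule span_induct) (auto simp: subspace_def J_add J_scale M that(1,2))
  have 2: "J a b c = 0" if "a \<in> M" "b \<in> span M" "c \<in> span M" for a b c
    using that(2) by (rule span_induct) (auto simp: subspace_def J_add J_scale 1 that(1,3))
  show ?thesis
    using abc(1) by (rule span_induct) (auto simp: subspace_def J_add J_scale 2 abc(2,3))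
qed

lemma mult_in_span:
  assumes M: "\<And>a b. a \<in> M \<Longrightarrow> b \<in> M \<Longrightarrow> a \<cdot> b \<in> M" and ab: "a \<in> span M" "b \<in> span M"
  shows "a \<cdot> b \<in> span M"
proof -
  have 1: "a \<cdot> b \<in> span M" if "a \<in> M" "b \<in> span M" for a b
    using that(2)
    by (rule span_induct)
      (auto simp: subspace_def mult_add_right mult_scale_right
        intro: span_add span_scale span_base M that(1) span_zero)
  show ?thesis
    using ab(1)
    by (rule span_induct)
      (auto simp: subspace_def mult_add_left mult_scale_left
        intro: span_add span_scale 1 ab(2) span_zero)
qed

lemma binary_leibniz: "binary_leibniz scale mult"
proof -
  have "J a b c = 0"
    if "a \<in> subalg_gen scale mult {x, y}" "b \<in> subalg_gen scale mult {x, y}"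
      "c \<in> subalg_gen scale mult {x, y}" for x y a b c
  proof -
    \<comment> \<open>The span of the monomials is a subalgebra containing \<open>x\<close> and
      \<open>y\<close>, hence contains the generated one; trilinearity extends the vanishing of
      \<open>J\<close> to it.\<close>
    define M where "M = {u. \<exists>k. monomial x y k u}"
    have "u \<cdot> v \<in> M" if "u \<in> M" "v \<in> M" for u v
      using that unfolding M_def by (blast intro: monomial.mult)
    then have "is_subalgebra scale mult (span M)"
      unfolding is_subalgebra_def by (blast intro: mult_in_span span_zero span_add span_scale)
    moreover have "{x, y} \<subseteq> span M"
      unfolding M_def by (blast intro: span_base monomial.intros)
    ultimately have "subalg_gen scale mult {x, y} \<subseteq> span M"
      unfolding subalg_gen_def by blast
    moreover have "J u v w = 0" if "u \<in> M" "v \<in> M" "w \<in> M" for u v w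
      using that J_vanishes[of x y] unfolding M_def vanishes_in_degree_def by blast
    ultimately show ?thesis
      using that by (blast intro: J_vanishes_on_span)
  qed
  then show ?thesis
    unfolding binary_leibniz_def leibniz_on_def by blast
qed

end

section \<open>Necessity of the identities and the equivalence\<close>

lemma generators_in_subalg_gen:
  "x \<in> subalg_gen scale mult {x, y}" "y \<in> subalg_gen scale mult {x, y}"
  "mult x y \<in> subalg_gen scale mult {x, y}"
  unfolding subalg_gen_def is_subalgebra_def by auto

theorem theorem2:
  fixes scale :: "'k::field \<Rightarrow> 'a::ab_group_add \<Rightarrow> 'a"
    and mult :: "'a \<Rightarrow> 'a \<Rightarrow> 'a"
  assumes "(2::'k) \<noteq> 0"
    and "nonassoc_algebra scale mult"
  shows "binary_leibniz scale mult \<longleftrightarrow>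
    (\<forall>a b. lassoc mult a a b = 0 \<and> lassoc mult a b a = 0 \<and> lassoc mult a b (mult a b) = 0)"
proof
  assume "binary_leibniz scale mult"
  \<comment> \<open>All arguments occurring, namely \<open>a\<close>, \<open>b\<close> and
    \<open>mult a b\<close>, lie in the subalgebra generated by \<open>a\<close> and
    \<open>b\<close>.\<close>
  then show "\<forall>a b. lassoc mult a a b = 0 \<and> lassoc mult a b a = 0 \<and> lassoc mult a b (mult a b) = 0"
    unfolding binary_leibniz_def leibniz_on_def by (blast intro: generators_in_subalg_gen)
next
  assume "\<forall>a b. lassoc mult a a b = 0 \<and> lassoc mult a b a = 0 \<and> lassoc mult a b (mult a b) = 0"
  with assms interpret leibnizator_alternating scale mult
    by unfold_locales auto
  show "binary_leibniz scale mult"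
    by (rule binary_leibniz)
qed

end
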